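(* Let $n$ be a positive integer, \[A^{\mathrm{Pinwheel}}_n=\begin{pmatrix}0&1\\1&2n\end{pmatrix},\] $L$ a $(p,q)$-leaper with $p<q$, and $M$ an $(r,s)$-leaper with \[\binom rs=A^{\mathrm{Pinwheel}}_n\binom pq.\] Then the pinwheel board $W_n(L)$ of order $n$ for $L$ is dual with respect to $L$ and $M$.
   Context: A square is a unit square of the infinite chessboard; a board is a set of squares. For nonnegative integers $p,q$, not both zero, a $(p,q)$-leaper is a piece that moves from a square $a$ to any of $a+(\pm p,\pm q)$, $a+(\pm q,\pm p)$; a $(p,q)$-leaper and a $(q,p)$-leaper are the same leaper. The leaper graph of $L$ over a board $B$ has the squares of $B$ as vertices, two being adjacent when a move of $L$ joins them. A board $B$ is dual with respect to two distinct leapers $L$ and $M$ if $B$ contains more than one square and the leaper graphs of $L$ and $M$ over $B$ are connected and isomorphic. Pinwheel boards. Given a $(p,q)$-leaper $L$ with $q\ne0$, use Cartesian coordinates with origin $O$ over the infinite chessboard such that the integer points are the vertices of the squares if $p+q$ is odd, and the centers of the squares if $p+q$ is even; $(x,y)$ denotes the square centered at $(x,y)$. Let $N^{\mathrm I}(L)$ be the set of all squares $(x,y)$ with $x\equiv\frac12(p+q)$ and $y\equiv\frac12(p-q)$ modulo $2q$. Let $R^{\mathrm I}_n(L)$ be the rectangle bounded by $p\le x+y\le p+2nq$ and $-(2n-1)q\le y-x\le(2n-1)q$, and let $W^{\mathrm I}_n(L)$ be the board formed by all squares of $N^{\mathrm I}(L)$ whose centers lie on the boundary or in the interior of $R^{\mathrm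 I}_n(L)$. Let $W^{\mathrm{II}}_n(L)$, $W^{\mathrm{III}}_n(L)$, $W^{\mathrm{IV}}_n(L)$ be the rotations of $W^{\mathrm I}_n(L)$ by $90^\circ$, $180^\circ$, and $270^\circ$ counterclockwise about $O$. The pinwheel board of order $n$ for $L$, $W_n(L)$, is the union of $W^{\mathrm I}_n(L)$, $W^{\mathrm{II}}_n(L)$, $W^{\mathrm{III}}_n(L)$, and $W^{\mathrm{IV}}_n(L)$. *)

theory Defs
  imports
    "HOL-Analysis.Analysis"
    "HOL-Library.Real_Mod"
    "Graph_Theory.Digraph_Isomorphism"
    "Graph_Theory.Pair_Digraph"
begin

type_synonym square = "int \<times> int"

type_synonym board = "square set"

text \<open>
  A leaper is identified with the set of its moves. Hence a \<open>(p,q)\<close>-leaper and a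
  \<open>(q,p)\<close>-leaper are the same leaper, and distinct leapers are distinct sets.
\<close>

type_synonym leaper = "(int \<times> int) set"

definition is_leaper :: "nat \<Rightarrow> nat \<Rightarrow> leaper \<Rightarrow> bool" where
  "is_leaper p q L \<longleftrightarrow> \<not> (p = 0 \<and> q = 0) \<and>
     L = {(x, y). \<bar>x\<bar> = int p \<and> \<bar>y\<bar> = int q \<or> \<bar>x\<bar> = int q \<and> \<bar>y\<bar> = int p}"

lemma is_leaper_commute: "is_leaper p q L \<longleftrightarrow> is_leaper q p L"
  by (auto simp: is_leaper_def)

text \<open>
  The undirected edge between \<open>a\<close> and \<open>b\<close> is represented by the two arcs \<open>(a, b)\<close> and
  \<open>(b, a)\<close>.
\<close>

definition leaper_graph :: "leaper \<Rightarrow> board \<Rightarrow> (square, square \<times> square) pre_digraph" where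
  "leaper_graph L B = with_proj \<lparr> pverts = B, parcs = {(a, b). a \<in> B \<and> b \<in> B \<and> b - a \<in> L} \<rparr>"

lemma symmetric_leaper_graph:
  assumes "is_leaper p q L"
  shows "symmetric (leaper_graph L B)"
  using assms by (auto simp: leaper_graph_def symmetric_def is_leaper_def sym_def abs_minus_commute)

lemma wf_leaper_graph: "wf_digraph (leaper_graph L B)"
  by unfold_locales (auto simp: leaper_graph_def)

text \<open>
  For leaper graphs, isomorphism of digraphs amounts to a bijection between the vertices that
  preserves and reflects adjacency.
\<close>

lemma digraph_iso_leaper_graph_iff:
  "digraph_iso (leaper_graph L B) (leaper_graph M C) \<longleftrightarrow>
     (\<exists>f. bij_betw f B C \<and> (\<forall>a\<in>B. \<forall>b\<in>B. b - a \<in> L \<longleftrightarrow> f b - f a \<in> M))"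
  (is "?lhs \<longleftrightarrow> ?rhs")
proof
  assume ?lhs
  then obtain h where h: "pre_digraph.digraph_isomorphism (leaper_graph L B) h"
    and M: "leaper_graph M C = app_iso h (leaper_graph L B)"
    by (auto simp: digraph_iso_def)
  let ?f = "iso_verts h"
  let ?EL = "{(a, b). a \<in> B \<and> b \<in> B \<and> b - a \<in> L}"
  let ?EM = "{(a, b). a \<in> C \<and> b \<in> C \<and> b - a \<in> M}"
  from M have C: "C = ?f ` B" and E: "?EM = iso_arcs h ` ?EL"
    and th: "iso_tail h = fst" "iso_head h = snd"
    by (auto simp: leaper_graph_def app_iso_def with_proj_def)
  from h have inj: "inj_on ?f B"
    by (auto simp: pre_digraph.digraph_isomorphism_def leaper_graph_def)
  have arc: "iso_arcs h e = (?f (fst e), ?f (snd e))" if "e \<in> ?EL" for e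
  proof -
    have "?f (fst e) = fst (iso_arcs h e) \<and> ?f (snd e) = snd (iso_arcs h e)"
      using h that th by (auto simp: pre_digraph.digraph_isomorphism_def leaper_graph_def)
    then show ?thesis by (simp add: prod_eq_iff)
  qed
  have E': "?EM = (\<lambda>e. (?f (fst e), ?f (snd e))) ` ?EL"
    unfolding E by (rule image_cong[OF refl arc])
  have "b - a \<in> L \<longleftrightarrow> ?f b - ?f a \<in> M" if ab: "a \<in> B" "b \<in> B" for a b
  proof
    assume "b - a \<in> L"
    then have "(?f a, ?f b) \<in> ?EM" unfolding E' using ab by (force intro: image_eqI[of _ _ "(a, b)"])
    then show "?f b - ?f a \<in> M" by simp
  next
    assume "?f b - ?f a \<in> M"
    then have "(?f a, ?f b) \<in> ?EM" using ab C by simp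
    then obtain e where "(?f a, ?f b) = (?f (fst e), ?f (snd e))" and e: "e \<in> ?EL"
      unfolding E' by (rule imageE)
    then have "?f a = ?f (fst e)" "?f b = ?f (snd e)" by simp_all
    moreover from e have "fst e \<in> B" "snd e \<in> B" and L: "snd e - fst e \<in> L"
      by (simp_all add: case_prod_beta)
    ultimately have "a = fst e" "b = snd e"
      using inj ab by (simp_all only: inj_on_eq_iff)
    with L show "b - a \<in> L" by simp
  qed
  with inj C show ?rhs by (auto simp: bij_betw_def)
next
  assume ?rhs
  then obtain f where f: "bij_betw f B C" "\<And>a b. a \<in> B \<Longrightarrow> b \<in> B \<Longrightarrow> b - a \<in> L \<longleftrightarrow> f b - f a \<in> M"
    by blast
  define h where "h = \<lparr> iso_verts = f, iso_arcs = map_prod f f, iso_head = snd, iso_tail = fst \<rparr>"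
  have "pre_digraph.digraph_isomorphism (leaper_graph L B) h"
    using f(1) wf_leaper_graph[of L B] unfolding pre_digraph.digraph_isomorphism_def
    by (auto simp: h_def leaper_graph_def bij_betw_def inj_on_def)
  moreover have "leaper_graph M C = app_iso h (leaper_graph L B)"
  proof -
    have C: "C = f ` B" using f(1) by (simp add: bij_betw_def)
    have "{(a, b). a \<in> C \<and> b \<in> C \<and> b - a \<in> M}
        = map_prod f f ` {(a, b). a \<in> B \<and> b \<in> B \<and> b - a \<in> L}" (is "?EM = map_prod f f ` ?EL")
    proof (intro set_eqI iffI)
      fix e assume "e \<in> ?EM"
      then obtain a b where ab: "a \<in> B" "b \<in> B" "e = (f a, f b)" "f b - f a \<in> M"
        unfolding C by blast
      then have "(a, b) \<in> ?EL" using f(2) by simp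
      then show "e \<in> map_prod f f ` ?EL" using ab(3) by (intro image_eqI[of _ _ "(a, b)"]) simp_all
    next
      fix e assume "e \<in> map_prod f f ` ?EL"
      then obtain d where d: "e = map_prod f f d" "d \<in> ?EL" by (rule imageE)
      obtain a b where "d = (a, b)" by (cases d)
      with d have "a \<in> B" "b \<in> B" "b - a \<in> L" "e = (f a, f b)" by simp_all
      then show "e \<in> ?EM" using f(2) C by simp
    qed
    with C show ?thesis by (simp add: leaper_graph_def app_iso_def h_def with_proj_def)
  qed
  ultimately show ?lhs by (auto simp: digraph_iso_def)
qed

definition dual :: "board \<Rightarrow> leaper \<Rightarrow> leaper \<Rightarrow> bool" where
  "dual B L M \<longleftrightarrow>
     (\<exists>p q. is_leaper p q L) \<and> (\<exists>r s. is_leaper r s M) \<and> L \<noteq> M \<and>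
     (\<exists>a\<in>B. \<exists>b\<in>B. a \<noteq> b) \<and>
     Digraph_Component.connected (leaper_graph L B) \<and>
     Digraph_Component.connected (leaper_graph M B) \<and>
     digraph_iso (leaper_graph L B) (leaper_graph M B)"

text \<open>
  The Cartesian coordinates of the center of a square. The origin is a vertex of a square if
  \<open>p + q\<close> is odd, and the center of a square if \<open>p + q\<close> is even.
\<close>

definition center :: "nat \<Rightarrow> nat \<Rightarrow> square \<Rightarrow> real \<times> real" where
  "center p q = (\<lambda>(i, j). if odd (p + q) then (of_int i + 1 / 2, of_int j + 1 / 2)
                          else (of_int i, of_int j))"

definition net_I :: "nat \<Rightarrow> nat \<Rightarrow> board" where
  "net_I p q = {a. case center p q a of (x, y) \<Rightarrow>
     [x = (real p + real q) / 2] (rmod 2 * real q) \<and>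
     [y = (real p - real q) / 2] (rmod 2 * real q)}"

definition rectangle_I :: "nat \<Rightarrow> nat \<Rightarrow> nat \<Rightarrow> (real \<times> real) set" where
  "rectangle_I n p q = {(x, y).
     real p \<le> x + y \<and> x + y \<le> real p + 2 * real n * real q \<and>
     - ((2 * real n - 1) * real q) \<le> y - x \<and> y - x \<le> (2 * real n - 1) * real q}"

definition wing_I :: "nat \<Rightarrow> nat \<Rightarrow> nat \<Rightarrow> board" where
  "wing_I n p q = {a \<in> net_I p q. center p q a \<in> rectangle_I n p q}"

definition rot90 :: "real \<times> real \<Rightarrow> real \<times> real" where
  "rot90 = (\<lambda>(x, y). (- y, x))"

text \<open>
  The four values of \<open>k\<close> yield the wing and its counterclockwise rotations by
  \<open>k\<close> right angles about the origin.
\<close>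

definition pinwheel_board :: "nat \<Rightarrow> nat \<Rightarrow> nat \<Rightarrow> board" where
  "pinwheel_board n p q =
     (\<Union>k<4. {a. center p q a \<in> (rot90 ^^ k) ` center p q ` wing_I n p q})"

definition A_pinwheel :: "nat \<Rightarrow> nat^2^2" where
  "A_pinwheel n = vector [vector [0, 1], vector [1, 2 * n]]"

lemma A_pinwheel_mult: "A_pinwheel n *v vector [p, q] = vector [q, p + 2 * n * q]"
  by (simp add: A_pinwheel_def vec_eq_iff matrix_vector_mult_def sum_2 forall_2)

end

theory Submission
  imports Defs
begin

text \<open>
  The board consists of four congruent wings, which are permuted cyclically by the quarter turn
  about the origin. In the first wing a square is determined by the integers \<open>(a, b)\<close> that
  count the steps of length \<open>2q\<close> along the two axes, and the rectangle becomes the condition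
  \<open>0 \<le> a + b \<le> n\<close>, \<open>1 - n \<le> b - a \<le> n\<close>, which involves neither \<open>p\<close> nor \<open>q\<close>.

  The leapers \<open>L\<close> and \<open>M\<close> are both \<open>(q, p + 2Nq)\<close>-leapers, with \<open>N = 0\<close> and \<open>N = n\<close>. Since
  \<open>0 \<le> p < q\<close>, divisibility by \<open>q\<close> shows that such a leaper never moves within a wing or to the
  opposite wing. Together with the bounds on the indices it also shows that from the square
  \<open>(a, b)\<close> of one wing its moves to the next wing, counted counterclockwise, are exactly those to
  \<open>(b, N - a)\<close> and \<open>(b - 1, N - a)\<close>, as far as these squares belong to the board
  (lemma \<open>site_edge_iff\<close>). So the two leaper graphs are described by the same rule up to
  the value of \<open>N\<close>, and an involution of the indices exchanges them (lemma \<open>link_flip_iff\<close>). If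
  \<open>n\<close> is odd, it turns every wing by \<open>180\<close> degrees about the center of the wing. If \<open>n\<close>
  is even, that half turn does not preserve the net; instead every wing is reflected and the
  cyclic order of the wings is reversed.

  For connectedness, which only has to be shown for \<open>L\<close>, a move to an adjacent wing followed by
  a move back shifts a square diagonally within its wing, towards one of the lines
  \<open>a + b = 0\<close> and \<open>a = b\<close>; from the first line a single move leads to the second, and on the
  second all squares are joined to the square \<open>(0, 0)\<close> (lemma \<open>linked_to_origin\<close>).
\<close>

section \<open>Coordinates on the pinwheel board\<close>

text \<open>
  The counterclockwise quarter turn about the origin, on squares. When \<open>p + q\<close> is odd, the square
  \<open>(i, j)\<close> is centered at \<open>(i + 1/2, j + 1/2)\<close>; this accounts for the summand
  \<open>(p + q) mod 2\<close>.
\<close>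

definition turn :: "nat \<Rightarrow> nat \<Rightarrow> square \<Rightarrow> square" where
  "turn p q = (\<lambda>(i, j). (- j - int ((p + q) mod 2), i))"

text \<open>
  The square of the net centered at \<open>((p + q) / 2 + 2qa, (p - q) / 2 + 2qb)\<close>. The rounding in
  \<open>(p + q) div 2\<close> absorbs the offset between a square and its center.
\<close>

definition wing_square :: "nat \<Rightarrow> nat \<Rightarrow> int \<times> int \<Rightarrow> square" where
  "wing_square p q = (\<lambda>(a, b). (int ((p + q) div 2) + 2 * int q * a,
                                int ((p + q) div 2) - int q + 2 * int q * b))"

text \<open>The indices \<open>(a, b)\<close> of the squares of the first wing.\<close>

definition wing_index :: "nat \<Rightarrow> (int \<times> int) set" where
  "wing_index n = {(a, b). 0 \<le> a + b \<and> a + b \<le> int n \<and> 1 - int n \<le> b - a \<and> b - a \<le> int n}"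

text \<open>
  The square of the \<open>k\<close>-th wing with index \<open>(a, b)\<close>, where the wings are numbered from \<open>0\<close> to
  \<open>3\<close> counterclockwise.
\<close>

definition site :: "nat \<Rightarrow> nat \<Rightarrow> nat \<times> int \<times> int \<Rightarrow> square" where
  "site p q = (\<lambda>(k, z). (turn p q ^^ k) (wing_square p q z))"

text \<open>The indices of the squares of the pinwheel board.\<close>

definition board_index :: "nat \<Rightarrow> (nat \<times> int \<times> int) set" where
  "board_index n = {..<4} \<times> wing_index n"

lemma center_turn: "center p q (turn p q a) = rot90 (center p q a)"
  by (cases a) (auto simp: center_def turn_def rot90_def mod_2_eq_odd simp flip: odd_iff_mod_2_eq_one)

lemma center_funpow_turn: "center p q ((turn p q ^^ k) a) = (rot90 ^^ k) (center p q a)"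
  by (induction k) (simp_all add: center_turn)

lemma center_eq_iff: "center p q a = center p q b \<longleftrightarrow> a = b"
  by (cases a; cases b) (auto simp: center_def)

lemma center_conv:
  "center p q (i, j) = (of_int i + real ((p + q) mod 2) / 2, of_int j + real ((p + q) mod 2) / 2)"
  by (auto simp: center_def mod_2_eq_odd simp flip: odd_iff_mod_2_eq_one)

lemma half_sum: "real ((p + q) mod 2) / 2 = (real p + real q) / 2 - real ((p + q) div 2)"
proof -
  have "p + q = 2 * ((p + q) div 2) + (p + q) mod 2" by simp
  then have "real (p + q) = real (2 * ((p + q) div 2) + (p + q) mod 2)" by (rule arg_cong)
  then show ?thesis by (simp only: of_nat_add of_nat_mult) (simp add: field_simps)
qed

lemma net_I_eq: "net_I p q = range (wing_square p q)"
proof (intro set_eqI)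
  fix s :: square
  obtain i j where s: "s = (i, j)" by (cases s)
  have 1: "[of_int i + real ((p + q) mod 2) / 2 = (real p + real q) / 2] (rmod 2 * real q) \<longleftrightarrow>
        (\<exists>a. i = int ((p + q) div 2) + 2 * int q * a)" (is "?l \<longleftrightarrow> ?r")
  proof -
    have "?l \<longleftrightarrow> [(real p + real q) / 2 = of_int i + real ((p + q) mod 2) / 2] (rmod 2 * real q)"
      by (rule rcong_sym_iff)
    also have "\<dots> \<longleftrightarrow> (\<exists>a. real_of_int i = real_of_int (int ((p + q) div 2) + 2 * int q * a))"
      unfolding half_sum rcong_altdef by (auto simp: algebra_simps)
    finally show ?thesis by (simp only: of_int_eq_iff)
  qed
  have 2: "[of_int j + real ((p + q) mod 2) / 2 = (real p - real q) / 2] (rmod 2 * real q) \<longleftrightarrow>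
        (\<exists>b. j = int ((p + q) div 2) - int q + 2 * int q * b)" (is "?l \<longleftrightarrow> ?r")
  proof -
    have "?l \<longleftrightarrow> [(real p - real q) / 2 = of_int j + real ((p + q) mod 2) / 2] (rmod 2 * real q)"
      by (rule rcong_sym_iff)
    also have "\<dots> \<longleftrightarrow>
        (\<exists>b. real_of_int j = real_of_int (int ((p + q) div 2) - int q + 2 * int q * b))"
      unfolding half_sum rcong_altdef
      by (auto simp: algebra_simps add_divide_distrib diff_divide_distrib)
    finally show ?thesis by (simp only: of_int_eq_iff)
  qed
  show "s \<in> net_I p q \<longleftrightarrow> s \<in> range (wing_square p q)"
    by (auto simp: net_I_def s center_conv 1 2 wing_square_def image_iff)
qed

lemma center_wing_square_in_rectangle_I:
  assumes "q > 0"
  shows "center p q (wing_square p q z) \<in> rectangle_I n p q \<longleftrightarrow> z \<in> wing_index n"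
proof -
  obtain a b where z: "z = (a, b)" by (cases z)
  define x y where "x = fst (center p q (wing_square p q z))"
    and "y = snd (center p q (wing_square p q z))"
  have c: "center p q (wing_square p q z) = (x, y)" by (simp add: x_def y_def)
  have q: "real q > 0" using assms by simp
  have sum: "x + y = real p + 2 * (real q * of_int (a + b))"
    and diff: "y - x = 2 * (real q * of_int (b - a)) - real q"
    unfolding x_def y_def z wing_square_def
    by (simp_all add: center_conv half_sum algebra_simps add_divide_distrib)
  have "real p \<le> x + y \<longleftrightarrow> real q * of_int 0 \<le> real q * of_int (a + b)" by (simp add: sum)
  then have 1: "real p \<le> x + y \<longleftrightarrow> 0 \<le> a + b"
    using q by (simp only: mult_le_cancel_left_pos of_int_le_iff)
  have "x + y \<le> real p + 2 * real n * real q \<longleftrightarrow> real q * of_int (a + b) \<le> real q * of_int (int n)"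
    unfolding sum by (simp add: mult.commute)
  then have 2: "x + y \<le> real p + 2 * real n * real q \<longleftrightarrow> a + b \<le> int n"
    using q by (simp only: mult_le_cancel_left_pos of_int_le_iff)
  have bounds: "(2 * real n - 1) * real q = 2 * (real n * real q) - real q"
    "real q * of_int (1 - int n) = real q - real n * real q"
    "real q * of_int (int n) = real n * real q"
    by (simp_all add: algebra_simps)
  have "- ((2 * real n - 1) * real q) \<le> y - x \<longleftrightarrow>
      real q * of_int (1 - int n) \<le> real q * of_int (b - a)"
    unfolding diff bounds by linarith
  then have 3: "- ((2 * real n - 1) * real q) \<le> y - x \<longleftrightarrow> 1 - int n \<le> b - a"
    using q by (simp only: mult_le_cancel_left_pos of_int_le_iff)
  have "y - x \<le> (2 * real n - 1) * real q \<longleftrightarrow>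
      real q * of_int (b - a) \<le> real q * of_int (int n)"
    unfolding diff bounds by linarith
  then have 4: "y - x \<le> (2 * real n - 1) * real q \<longleftrightarrow> b - a \<le> int n"
    using q by (simp only: mult_le_cancel_left_pos of_int_le_iff)
  show ?thesis
    unfolding c by (simp only: rectangle_I_def mem_Collect_eq prod.case 1 2 3 4 wing_index_def z)
qed

lemma wing_I_eq: "q > 0 \<Longrightarrow> wing_I n p q = wing_square p q ` wing_index n"
  by (auto simp: wing_I_def net_I_eq center_wing_square_in_rectangle_I)

lemma pinwheel_board_eq:
  assumes "q > 0"
  shows "pinwheel_board n p q = site p q ` board_index n"
proof -
  have "{a. center p q a \<in> (rot90 ^^ k) ` center p q ` wing_I n p q} = (turn p q ^^ k) ` wing_I n p q" for k
    by (auto simp: image_image center_eq_iff simp flip: center_funpow_turn)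
  then have "pinwheel_board n p q = (\<Union>k<4. (turn p q ^^ k) ` wing_square p q ` wing_index n)"
    by (simp only: pinwheel_board_def wing_I_eq[OF assms])
  also have "\<dots> = site p q ` board_index n"
    by (force simp: site_def board_index_def)
  finally show ?thesis .
qed

section \<open>Adjacency on the pinwheel board\<close>

text \<open>
  \<open>step N z z'\<close> says that a \<open>(q, p + 2Nq)\<close>-leaper moves from the square with index \<open>z\<close> of
  a wing to the square with index \<open>z'\<close> of the next wing; this meaning is justified by
  \<open>edge_to_next_wing\<close> below.
\<close>

definition step :: "nat \<Rightarrow> int \<times> int \<Rightarrow> int \<times> int \<Rightarrow> bool" where
  "step N = (\<lambda>(a, b) (a', b'). b' = int N - a \<and> (a' = b \<or> a' = b - 1))"

text \<open>
  Adjacency of board indices for a \<open>(q, p + 2Nq)\<close>-leaper: the wings are adjacent in the cyclic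
  order, and the earlier one of them steps to the later one.
\<close>

definition link :: "nat \<Rightarrow> nat \<times> int \<times> int \<Rightarrow> nat \<times> int \<times> int \<Rightarrow> bool" where
  "link N = (\<lambda>(k, z) (k', z').
     k' = (k + 1) mod 4 \<and> step N z z' \<or> k = (k' + 1) mod 4 \<and> step N z' z)"

lemma turn_diff:
  "turn p q x - turn p q y = (- snd (x - y), fst (x - y))"
  by (cases x; cases y) (simp add: turn_def)

lemma turn_eq_iff: "turn p q x = turn p q y \<longleftrightarrow> x = y"
  by (cases x; cases y) (auto simp: turn_def)

lemma funpow_turn_eq_iff: "(turn p q ^^ k) x = (turn p q ^^ k) y \<longleftrightarrow> x = y"
  by (induction k) (simp_all add: turn_eq_iff)

lemma funpow_turn_4: "(turn p q ^^ 4) x = x"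
  by (cases x) (simp add: turn_def eval_nat_numeral)

lemma turn_diff_in_leaper:
  assumes "is_leaper r s K"
  shows "turn p q x - turn p q y \<in> K \<longleftrightarrow> x - y \<in> K"
  using assms unfolding turn_diff by (cases x; cases y) (auto simp: is_leaper_def)

lemma funpow_turn_diff_in_leaper:
  assumes "is_leaper r s K"
  shows "(turn p q ^^ k) x - (turn p q ^^ k) y \<in> K \<longleftrightarrow> x - y \<in> K"
  by (induction k) (simp_all add: turn_diff_in_leaper[OF assms])

lemma leaper_diff_commute:
  assumes "is_leaper r s K"
  shows "x - y \<in> K \<longleftrightarrow> y - x \<in> K"
  using assms by (cases x; cases y) (auto simp: is_leaper_def abs_minus_commute)

lemma mult_eq_small:
  fixes c :: int
  assumes "int p = int q * c" "p < q"
  shows "c = 0" "p = 0"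
proof -
  show "c = 0"
  proof (rule ccontr)
    assume "c \<noteq> 0"
    then have "int q * c \<noteq> 0" using assms(2) by simp
    then have "int p > 0" using assms(1) by linarith
    moreover have "int q dvd int p" using assms(1) by simp
    ultimately show False using assms(2) zdvd_imp_le[of "int q" "int p"] by simp
  qed
  then show "p = 0" using assms(1) by simp
qed

text \<open>
  Within a wing both coordinates of a difference are even multiples of \<open>q\<close>, but one coordinate of
  every move is \<open>\<plusminus>q\<close>.
\<close>

lemma no_edge_in_wing:
  assumes "p < q" "is_leaper q (p + 2 * N * q) K"
  shows "wing_square p q z' - wing_square p q z \<notin> K"
proof -
  have odd: "\<bar>2 * int q * m\<bar> \<noteq> int q" for m
  proof
    assume "\<bar>2 * int q * m\<bar> = int q"
    then have "int q * \<bar>2 * m\<bar> = int q * 1" by (simp add: abs_mult)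
    then have "\<bar>2 * m\<bar> = 1" using assms(1) by (simp only: mult_cancel_left) auto
    then show False by presburger
  qed
  obtain a b a' b' where z: "z = (a, b)" "z' = (a', b')" by (cases z; cases z')
  have "wing_square p q z' - wing_square p q z = (2 * int q * (a' - a), 2 * int q * (b' - b))"
    by (simp add: z wing_square_def algebra_simps)
  then show ?thesis using assms(2) odd by (auto simp: is_leaper_def)
qed

lemma turn_wing_square_diff:
  "turn p q (wing_square p q (a', b')) - wing_square p q (a, b) =
     (- (int p + 2 * int q * (a + b')), int q * (1 + 2 * (a' - b)))"
proof -
  have "int ((p + q) mod 2) = int p + int q - 2 * int ((p + q) div 2)"
    by (simp add: zmod_int zdiv_int flip: minus_mult_div_eq_mod)
  then show ?thesis by (simp add: turn_def wing_square_def algebra_simps)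
qed

lemma turn_turn_wing_square_diff:
  "turn p q (turn p q (wing_square p q (a', b'))) - wing_square p q (a, b) =
     (- (int p + int q * (1 + 2 * (a + a'))), - (int p + int q * (2 * (b + b') - 1)))"
proof -
  have "int ((p + q) mod 2) = int p + int q - 2 * int ((p + q) div 2)"
    by (simp add: zmod_int zdiv_int flip: minus_mult_div_eq_mod)
  then show ?thesis by (simp add: turn_def wing_square_def algebra_simps)
qed

lemma no_edge_to_opposite_wing:
  assumes "p < q" "is_leaper q (p + 2 * N * q) K"
  shows "turn p q (turn p q (wing_square p q z')) - wing_square p q z \<notin> K"
proof
  assume K: "turn p q (turn p q (wing_square p q z')) - wing_square p q z \<in> K"
  obtain a b a' b' where z: "z = (a, b)" "z' = (a', b')" by (cases z; cases z')
  \<comment> \<open>The first equation forces \<open>p = 0\<close>; then an odd and an even multiple of \<open>q\<close> agree.\<close>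
  have key: False
    if "\<bar>int p + int q * c\<bar> = int q" "\<bar>int p + int q * d\<bar> = int p + 2 * int N * int q" "odd d" for c d
  proof -
    have "int p = int q * (1 - c) \<or> int p = int q * (- 1 - c)"
      using that(1) by (auto simp: algebra_simps abs_if split: if_splits)
    then have p: "p = 0" using mult_eq_small(2) assms(1) by blast
    have "int q * \<bar>d\<bar> = int q * (2 * int N)"
      using that(2) by (simp add: p abs_mult algebra_simps)
    then have "\<bar>d\<bar> = 2 * int N" using assms(1) by (simp only: mult_cancel_left) auto
    then show False using that(3) by presburger
  qed
  show False
    using K assms(2) key[of "1 + 2 * (a + a')" "2 * (b + b') - 1"]
      key[of "2 * (b + b') - 1" "1 + 2 * (a + a')"]
    by (auto simp: z turn_turn_wing_square_diff is_leaper_def abs_minus_commute simp del: minus_add_distrib)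
qed

text \<open>
  For \<open>p = 0\<close> divisibility alone would also allow moves with \<open>a + b' = - N\<close>. For \<open>N = 0\<close> this is
  nothing new, and for \<open>N = n\<close> such moves leave the board, which is why \<open>N\<close> is restricted to
  these two values.
\<close>

lemma edge_to_next_wing:
  assumes "p < q" "is_leaper q (p + 2 * N * q) K" "N = 0 \<or> N = n"
    and z: "z \<in> wing_index n" "z' \<in> wing_index n"
  shows "turn p q (wing_square p q z') - wing_square p q z \<in> K \<longleftrightarrow> step N z z'"
proof -
  obtain a b a' b' where zz: "z = (a, b)" "z' = (a', b')" by (cases z; cases z')
  define m c where "m = a + b'" and "c = a' - b"
  have q: "int q > 0" using assms(1) by simp
  have "turn p q (wing_square p q z') - wing_square p q z \<in> K \<longleftrightarrow>
      \<bar>int p + 2 * int q * m\<bar> = int q \<and> \<bar>int q * (1 + 2 * c)\<bar> = int p + 2 * int N * int q \<or>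
      \<bar>int p + 2 * int q * m\<bar> = int p + 2 * int N * int q \<and> \<bar>int q * (1 + 2 * c)\<bar> = int q"
    using assms(2)
    by (auto simp: zz turn_wing_square_diff is_leaper_def m_def c_def simp del: minus_add_distrib)
  moreover have "\<not> \<bar>int p + 2 * int q * m\<bar> = int q"
  proof
    assume "\<bar>int p + 2 * int q * m\<bar> = int q"
    then have "int p = int q * (1 - 2 * m) \<or> int p = int q * (- 1 - 2 * m)"
      by (auto simp: algebra_simps abs_if split: if_splits)
    then have "1 - 2 * m = 0 \<or> - 1 - 2 * m = 0"
      using mult_eq_small(1) assms(1) by blast
    then show False by presburger
  qed
  moreover have "\<bar>int q * (1 + 2 * c)\<bar> = int q \<longleftrightarrow> c = 0 \<or> c = - 1"
  proof -
    have "\<bar>int q * (1 + 2 * c)\<bar> = int q \<longleftrightarrow> int q * \<bar>1 + 2 * c\<bar> = int q * 1"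
      by (simp add: abs_mult)
    also have "\<dots> \<longleftrightarrow> \<bar>1 + 2 * c\<bar> = 1" using q by (simp only: mult_cancel_left) auto
    also have "\<dots> \<longleftrightarrow> c = 0 \<or> c = - 1" by presburger
    finally show ?thesis .
  qed
  moreover have "\<bar>int p + 2 * int q * m\<bar> = int p + 2 * int N * int q \<longleftrightarrow>
      m = int N \<or> int p = 0 \<and> m = - int N" (is "?l \<longleftrightarrow> ?r")
  proof
    assume ?l
    then consider "int q * m = int q * int N" | "int p = int q * (- (m + int N))"
      by (auto simp: abs_if algebra_simps split: if_splits)
    then show ?r
    proof cases
      case 1
      then show ?thesis using q by simp
    next
      case 2
      then have "- (m + int N) = 0" using mult_eq_small(1) assms(1) by blast
      then show ?thesis using 2 by auto
    qed
  next
    assume ?r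
    then show ?l using q by (auto simp: abs_mult)
  qed
  ultimately have "turn p q (wing_square p q z') - wing_square p q z \<in> K \<longleftrightarrow>
      (m = int N \<or> int p = 0 \<and> m = - int N) \<and> (c = 0 \<or> c = - 1)"
    by simp
  \<comment> \<open>The alternative \<open>m = - N\<close> is excluded by the bounds on the indices.\<close>
  also have "\<dots> \<longleftrightarrow> m = int N \<and> (c = 0 \<or> c = - 1)"
    using z assms(3) by (auto simp: wing_index_def zz m_def c_def)
  also have "\<dots> \<longleftrightarrow> step N z z'"
    by (auto simp: step_def zz m_def c_def)
  finally show ?thesis .
qed

lemma edge_to_previous_wing:
  assumes "p < q" "is_leaper q (p + 2 * N * q) K" "N = 0 \<or> N = n"
    and z: "z \<in> wing_index n" "z' \<in> wing_index n"
  shows "(turn p q ^^ 3) (wing_square p q z') - wing_square p q z \<in> K \<longleftrightarrow> step N z' z"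
proof -
  have "(turn p q ^^ 3) (wing_square p q z') - wing_square p q z \<in> K \<longleftrightarrow>
      turn p q ((turn p q ^^ 3) (wing_square p q z')) - turn p q (wing_square p q z) \<in> K"
    by (simp only: turn_diff_in_leaper[OF assms(2)])
  also have "turn p q ((turn p q ^^ 3) (wing_square p q z')) = (turn p q ^^ 4) (wing_square p q z')"
    by (simp add: eval_nat_numeral)
  also have "\<dots> = wing_square p q z'" by (rule funpow_turn_4)
  also have "wing_square p q z' - turn p q (wing_square p q z) \<in> K \<longleftrightarrow> step N z' z"
    unfolding leaper_diff_commute[OF assms(2), of "wing_square p q z'"]
    by (rule edge_to_next_wing[OF assms(1-3) z(2,1)])
  finally show ?thesis .
qed

lemma link_commute: "link N x y \<longleftrightarrow> link N y x"
  by (auto simp: link_def)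

lemma site_edge_iff:
  assumes "p < q" "is_leaper q (p + 2 * N * q) K" "N = 0 \<or> N = n"
    and "x \<in> board_index n" "y \<in> board_index n"
  shows "site p q y - site p q x \<in> K \<longleftrightarrow> link N x y"
proof -
  have ordered: "site p q (j, w) - site p q (k, z) \<in> K \<longleftrightarrow> link N (k, z) (j, w)"
    if "k \<le> j" "j < 4" "z \<in> wing_index n" "w \<in> wing_index n" for j k z w
  proof -
    define d where "d = j - k"
    have j: "j = k + d" using that(1) by (simp add: d_def)
    have diff: "site p q (j, w) - site p q (k, z) \<in> K \<longleftrightarrow>
        (turn p q ^^ d) (wing_square p q w) - wing_square p q z \<in> K"
      by (simp add: site_def j funpow_add funpow_turn_diff_in_leaper[OF assms(2)])
    have next_iff: "j = (k + 1) mod 4 \<longleftrightarrow> d = 1"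
      using \<open>j < 4\<close> by (cases "k = 3") (auto simp: j)
    have previous_iff: "k = (j + 1) mod 4 \<longleftrightarrow> d = 3"
      using \<open>j < 4\<close> by (cases "j = 3") (auto simp: j)
    have two: "(turn p q ^^ 2) (wing_square p q w) = turn p q (turn p q (wing_square p q w))"
      by (simp add: eval_nat_numeral)
    consider "d = 0" | "d = 1" | "d = 2" | "d = 3"
      using \<open>j < 4\<close> j by linarith
    then show ?thesis
      unfolding link_def prod.case diff next_iff previous_iff
      by cases (simp_all add: two no_edge_in_wing[OF assms(1,2)]
          no_edge_to_opposite_wing[OF assms(1,2)] edge_to_next_wing[OF assms(1-3) that(3,4)]
          edge_to_previous_wing[OF assms(1-3) that(3,4)])
  qed
  obtain k z j w where xy: "x = (k, z)" "y = (j, w)" by (cases x; cases y)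
  show ?thesis
  proof (cases "k \<le> j")
    case True
    then show ?thesis using ordered assms(4,5) by (auto simp: xy board_index_def)
  next
    case False
    then show ?thesis
      using ordered[of j k w z] assms(4,5) link_commute[of N x y]
        leaper_diff_commute[OF assms(2), of "site p q y"]
      by (auto simp: xy board_index_def)
  qed
qed

lemma inj_on_site:
  assumes "p < q"
  shows "inj_on (site p q) (board_index n)"
proof -
  have q: "int q > 0" using assms by simp
  have nz: "int q * (1 + 2 * c) \<noteq> 0" for c
  proof -
    have "1 + 2 * c \<noteq> 0" by presburger
    then show ?thesis using q by simp
  qed
  have 0: "w = z" if "wing_square p q w = wing_square p q z" for z w
    using that assms by (cases z; cases w) (simp add: wing_square_def)
  have 1: "turn p q (wing_square p q w) \<noteq> wing_square p q z" for z w
  proof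
    assume "turn p q (wing_square p q w) = wing_square p q z"
    then have "turn p q (wing_square p q (fst w, snd w)) - wing_square p q (fst z, snd z) = 0" by simp
    then show False
      unfolding turn_wing_square_diff zero_prod_def using nz[of "fst w - snd z"] by blast
  qed
  have 2: "turn p q (turn p q (wing_square p q w)) \<noteq> wing_square p q z" for z w
  proof
    assume "turn p q (turn p q (wing_square p q w)) = wing_square p q z"
    then have "turn p q (turn p q (wing_square p q (fst w, snd w))) - wing_square p q (fst z, snd z) = 0"
      by simp
    then have "int p + int q * (1 + 2 * (fst z + fst w)) = 0"
      unfolding turn_turn_wing_square_diff zero_prod_def prod.inject by linarith
    then have "int p = int q * (- 1 - 2 * (fst z + fst w))" by algebra
    then have "- 1 - 2 * (fst z + fst w) = 0"
      using mult_eq_small(1) assms by blast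
    then show False by presburger
  qed
  have 3: "(turn p q ^^ 3) (wing_square p q w) \<noteq> wing_square p q z" for z w
  proof
    assume "(turn p q ^^ 3) (wing_square p q w) = wing_square p q z"
    then have "turn p q (wing_square p q z) = (turn p q ^^ 4) (wing_square p q w)"
      by (simp add: eval_nat_numeral)
    then show False using 1 by (simp add: funpow_turn_4)
  qed
  have ordered: "j = k \<and> w = z"
    if "k \<le> j" "j < 4" "site p q (j, w) = site p q (k, z)" for j k z w
  proof -
    define d where "d = j - k"
    have j: "j = k + d" using that(1) by (simp add: d_def)
    have eq: "(turn p q ^^ d) (wing_square p q w) = wing_square p q z"
      using that(3) by (simp add: site_def j funpow_add funpow_turn_eq_iff)
    have two: "(turn p q ^^ 2) (wing_square p q w) = turn p q (turn p q (wing_square p q w))"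
      by (simp add: eval_nat_numeral)
    consider "d = 0" | "d = 1" | "d = 2" | "d = 3"
      using \<open>j < 4\<close> j by linarith
    then show ?thesis
    proof cases
      case d: 1
      then show ?thesis using eq 0[of w z] by (simp add: j)
    next
      case d: 2
      then show ?thesis using eq 1 by simp
    next
      case d: 3
      then show ?thesis using eq two 2 by simp
    next
      case d: 4
      then show ?thesis using eq 3 by simp
    qed
  qed
  show ?thesis
  proof (rule inj_onI)
    fix x y assume xy: "x \<in> board_index n" "y \<in> board_index n" "site p q x = site p q y"
    obtain k z j w where "x = (k, z)" "y = (j, w)" by (cases x; cases y)
    with xy have "k < 4" "j < 4" "site p q (k, z) = site p q (j, w)"
      by (simp_all add: board_index_def)
    then have "j = k \<and> w = z"
      using ordered[of k j w z] ordered[of j k z w] nat_le_linear[of j k] by metis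
    then show "x = y" by (simp add: \<open>x = _\<close> \<open>y = _\<close>)
  qed
qed

section \<open>Connectedness\<close>

text \<open>
  With \<open>u = a + b\<close> and \<open>v = b - a\<close>, a detour through the next wing leads from \<open>(u, v)\<close> to
  \<open>(u - 1, v - 1)\<close> if \<open>u, v \<ge> 1\<close>, and a detour through the previous wing leads to
  \<open>(u - 1, v + 1)\<close> if \<open>u \<ge> 1\<close> and \<open>v \<le> 0\<close>. A square with \<open>u = 0\<close> and \<open>v \<noteq> 0\<close> is adjacent to
  the square \<open>(\<bar>v\<bar>, 0)\<close> of the next or previous wing, and \<open>(u, 0)\<close> with \<open>u > 0\<close> is joined
  to \<open>(u - 2, 0)\<close>, because \<open>u\<close> and \<open>v\<close> have the same parity.
\<close>

lemma linked_to_origin: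
  assumes "k < 4" "(a, b) \<in> wing_index n"
  defines "E \<equiv> {(x, y). x \<in> board_index n \<and> y \<in> board_index n \<and> link 0 x y}"
  shows "((k, a, b), (0, 0, 0)) \<in> E\<^sup>*"
proof -
  have sym: "(x, y) \<in> E \<Longrightarrow> (y, x) \<in> E" for x y
    using link_commute by (auto simp: E_def)
  have next_wing: "((k, a, b), (Suc k mod 4, a', - a)) \<in> E"
    if "k < 4" "(a, b) \<in> wing_index n" "(a', - a) \<in> wing_index n" "a' = b \<or> a' = b - 1"
    for k a b a'
    using that by (auto simp: E_def link_def step_def board_index_def)
  have prev_wing: "((k, a, b), ((k + 3) mod 4, - b, b')) \<in> E"
    if "k < 4" "(a, b) \<in> wing_index n" "(- b, b') \<in> wing_index n" "a = b' \<or> a = b' - 1"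
    for k a b b'
  proof -
    have "k = ((k + 3) mod 4 + 1) mod 4" using that(1) by presburger
    then show ?thesis using that by (auto simp: E_def link_def step_def board_index_def)
  qed
  have wing_origin: "(0, 0) \<in> wing_index n"
    using assms(2) by (auto simp: wing_index_def)
  have origin: "((k, 0, 0), (0, 0, 0)) \<in> E\<^sup>*" if "k < 4" for k
    using that
  proof (induction k)
    case (Suc k)
    have "((k, 0, 0), (Suc k, 0, 0)) \<in> E"
      using next_wing[of k 0 0 0] wing_origin Suc.prems by simp
    then have "((Suc k, 0, 0), (k, 0, 0)) \<in> E" by (rule sym)
    then show ?case using Suc by (meson Suc_lessD converse_rtrancl_into_rtrancl)
  qed simp
  have via_next: "((k, a, b), (k, a, b - 1)) \<in> E\<^sup>*"
    if "k < 4" "(a, b) \<in> wing_index n" "a + b \<ge> 1" "b - a \<ge> 1" for k a b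
  proof -
    have "((k, a, b), (Suc k mod 4, b - 1, - a)) \<in> E"
      "((k, a, b - 1), (Suc k mod 4, b - 1, - a)) \<in> E"
      using that by (auto intro!: next_wing simp: wing_index_def)
    then show ?thesis using sym by (meson r_into_rtrancl rtrancl.rtrancl_into_rtrancl)
  qed
  have via_prev: "((k, a, b), (k, a - 1, b)) \<in> E\<^sup>*"
    if "k < 4" "(a, b) \<in> wing_index n" "a + b \<ge> 1" "b - a \<le> 0" for k a b
  proof -
    have "((k, a, b), ((k + 3) mod 4, - b, a)) \<in> E"
      "((k, a - 1, b), ((k + 3) mod 4, - b, a)) \<in> E"
      using that by (auto intro!: prev_wing simp: wing_index_def)
    then show ?thesis using sym by (meson r_into_rtrancl rtrancl.rtrancl_into_rtrancl)
  qed
  show ?thesis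
    using assms(1,2)
    \<comment> \<open>The weights make the passage from \<open>u = 0\<close> to \<open>v = 0\<close>, which keeps \<open>u + \<bar>v\<bar>\<close>, a descent.\<close>
  proof (induction "nat (2 * (a + b) + 3 * \<bar>b - a\<bar>)" arbitrary: k a b rule: less_induct)
    case less
    from less.prems have w: "0 \<le> a + b" "a + b \<le> int n" "1 - int n \<le> b - a" "b - a \<le> int n"
      by (auto simp: wing_index_def)
    consider "a + b \<ge> 1" "b - a \<ge> 1" | "a + b \<ge> 1" "b - a \<le> -1" | "a + b \<ge> 1" "a = b"
      | "a = 0" "b = 0" | "a = - b" "b > 0" | "a = - b" "b < 0"
      using w by linarith
    then show ?case
    proof cases
      case 1
      have "((k, a, b - 1), (0, 0, 0)) \<in> E\<^sup>*"
        using 1 w less.prems by (intro less.hyps) (auto simp: wing_index_def)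
      then show ?thesis using via_next[OF less.prems 1] by (rule rtrancl_trans[rotated])
    next
      case 2
      have "((k, a - 1, b), (0, 0, 0)) \<in> E\<^sup>*"
        using 2 w less.prems by (intro less.hyps) (auto simp: wing_index_def)
      moreover have "((k, a, b), (k, a - 1, b)) \<in> E\<^sup>*"
        using 2 by (intro via_prev[OF less.prems]) simp_all
      ultimately show ?thesis by (rule rtrancl_trans[rotated])
    next
      case 3
      then have "b \<ge> 1" by presburger
      have "((k, a - 1, b - 1), (0, 0, 0)) \<in> E\<^sup>*"
        using \<open>b \<ge> 1\<close> 3 w less.prems by (intro less.hyps) (auto simp: wing_index_def)
      moreover have "((k, a - 1, b), (k, a - 1, b - 1)) \<in> E\<^sup>*"
      proof (rule via_next)
        show "(a - 1, b) \<in> wing_index n" using \<open>b \<ge> 1\<close> 3 w by (simp add: wing_index_def)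
        show "a - 1 + b \<ge> 1" "b - (a - 1) \<ge> 1" using \<open>b \<ge> 1\<close> 3 by linarith+
      qed (fact less.prems(1))
      moreover have "((k, a, b), (k, a - 1, b)) \<in> E\<^sup>*"
        using 3 by (intro via_prev[OF less.prems]) simp_all
      ultimately show ?thesis by (meson rtrancl_trans)
    next
      case 4
      then show ?thesis using origin less.prems by simp
    next
      case 5
      have "((Suc k mod 4, b, b), (0, 0, 0)) \<in> E\<^sup>*"
        using 5 w less.prems by (intro less.hyps) (auto simp: wing_index_def)
      moreover have "((k, a, b), (Suc k mod 4, b, b)) \<in> E"
        using 5 w less.prems next_wing[of k a b b] by (auto simp: wing_index_def)
      ultimately show ?thesis by (rule converse_rtrancl_into_rtrancl[rotated])
    next
      case 6
      have "(((k + 3) mod 4, a, a), (0, 0, 0)) \<in> E\<^sup>*"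
        using 6 w less.prems by (intro less.hyps) (auto simp: wing_index_def)
      moreover have "((k, a, b), ((k + 3) mod 4, a, a)) \<in> E"
        using 6 w less.prems prev_wing[of k a b a] by (auto simp: wing_index_def)
      ultimately show ?thesis by (rule converse_rtrancl_into_rtrancl[rotated])
    qed
  qed
qed

lemma connected_leaper_graphI:
  assumes "is_leaper r s K" "c \<in> B"
    and reach: "\<And>a. a \<in> B \<Longrightarrow> (a, c) \<in> {(x, y). x \<in> B \<and> y \<in> B \<and> y - x \<in> K}\<^sup>*"
  shows "Digraph_Component.connected (leaper_graph K B)"
proof -
  let ?E = "{(x, y). x \<in> B \<and> y \<in> B \<and> y - x \<in> K}"
  have ends: "arcs_ends (leaper_graph K B) = ?E"
    by (auto simp: leaper_graph_def arcs_ends_def arc_to_ends_def)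
  have verts: "verts (leaper_graph K B) = B" by (simp add: leaper_graph_def)
  have "sym ?E" using leaper_diff_commute[OF assms(1)] by (auto intro: symI)
  then have sym: "sym (?E\<^sup>*)" by (rule sym_rtrancl)
  have on: "(a, b) \<in> rtrancl_on B (?E\<^sup>s)" if "(a, b) \<in> ?E\<^sup>*" "a \<in> B" for a b
    using that
  proof (induction rule: rtrancl_induct)
    case (step y z)
    then show ?case by (intro rtrancl_on_into_rtrancl_on[OF step.IH]) (auto simp: symcl_def)
  qed simp
  have "(a, b) \<in> rtrancl_on B (?E\<^sup>s)" if "a \<in> B" "b \<in> B" for a b
  proof -
    have "(c, b) \<in> ?E\<^sup>*" using sym reach[OF that(2)] by (rule symD)
    with reach[OF that(1)] have "(a, b) \<in> ?E\<^sup>*" by (rule rtrancl_trans)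
    then show ?thesis using that(1) by (rule on)
  qed
  then show ?thesis using assms(2) unfolding connected_conv ends verts by auto
qed

lemma connected_pinwheel_board:
  assumes "p < q" "is_leaper p q L" "n > 0"
  shows "Digraph_Component.connected (leaper_graph L (pinwheel_board n p q))"
proof -
  have L: "is_leaper q (p + 2 * 0 * q) L" using assms(2) is_leaper_commute by simp
  have B: "pinwheel_board n p q = site p q ` board_index n"
    using assms(1) by (intro pinwheel_board_eq) simp
  have edge: "site p q y - site p q x \<in> L \<longleftrightarrow> link 0 x y"
    if "x \<in> board_index n" "y \<in> board_index n" for x y
    using site_edge_iff[OF assms(1) L] that by blast
  let ?F = "{(x, y). x \<in> board_index n \<and> y \<in> board_index n \<and> link 0 x y}"
  let ?E = "{(x, y). x \<in> pinwheel_board n p q \<and> y \<in> pinwheel_board n p q \<and> y - x \<in> L}"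
  have map: "(site p q x, site p q y) \<in> ?E\<^sup>*" if "(x, y) \<in> ?F\<^sup>*" for x y
    using that
  proof (induction rule: rtrancl_induct)
    case (step y z)
    then have "(site p q y, site p q z) \<in> ?E" using edge by (auto simp: B)
    with step.IH show ?case by (rule rtrancl_into_rtrancl)
  qed simp
  show ?thesis
  proof (rule connected_leaper_graphI[OF L, of "site p q (0, 0, 0)"])
    show "site p q (0, 0, 0) \<in> pinwheel_board n p q"
      using assms(3) by (auto simp: B board_index_def wing_index_def)
  next
    fix s assume "s \<in> pinwheel_board n p q"
    then obtain k a b where s: "s = site p q (k, a, b)" and k: "k < 4" "(a, b) \<in> wing_index n"
      by (auto simp: B board_index_def)
    show "(s, site p q (0, 0, 0)) \<in> ?E\<^sup>*"
      unfolding s by (rule map[OF linked_to_origin[OF k]])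
  qed
qed

section \<open>The isomorphism\<close>

text \<open>
  The involution of the indices that turns adjacency for \<open>L\<close> into adjacency for \<open>M\<close>. In terms of
  \<open>u = a + b\<close> and \<open>v = b - a\<close> it maps \<open>(u, v)\<close> to \<open>(n - u, 1 - v)\<close> in the same wing if \<open>n\<close> is odd,
  and to \<open>(n - u, v)\<close> in the wing \<open>- k\<close> modulo \<open>4\<close> if \<open>n\<close> is even; in both cases \<open>u\<close> and \<open>v\<close> keep
  a common parity.
\<close>

definition flip :: "nat \<Rightarrow> nat \<times> int \<times> int \<Rightarrow> nat \<times> int \<times> int" where
  "flip n = (\<lambda>(k, a, b).
     if odd n then (k, int (n div 2) - a, int (n div 2) + 1 - b)
     else ((4 - k) mod 4, int (n div 2) - b, int (n div 2) - a))"

lemma flip_flip: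
  assumes "fst x < 4"
  shows "flip n (flip n x) = x"
proof -
  obtain k a b where x: "x = (k, a, b)" by (cases x)
  have "k = 0 \<or> k = 1 \<or> k = 2 \<or> k = 3" using assms x by auto
  then have "(4 - (4 - k) mod 4) mod 4 = k" by (elim disjE) simp_all
  then show ?thesis by (simp add: x flip_def)
qed

lemma flip_in_board_index:
  assumes "x \<in> board_index n"
  shows "flip n x \<in> board_index n"
proof (cases "odd n")
  case True
  then obtain m where "n = 2 * m + 1" by (rule oddE)
  then show ?thesis using assms by (auto simp: flip_def board_index_def wing_index_def)
next
  case False
  then have "even n" by simp
  then obtain m where "n = 2 * m" by (rule evenE)
  then show ?thesis using assms by (auto simp: flip_def board_index_def wing_index_def)
qed

lemma bij_betw_flip: "bij_betw (flip n) (board_index n) (board_index n)"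
proof (rule bij_betw_byWitness[where f' = "flip n"])
  show "\<forall>x\<in>board_index n. flip n (flip n x) = x"
    by (auto simp: board_index_def intro!: flip_flip)
  then show "\<forall>x\<in>board_index n. flip n (flip n x) = x" .
  show "flip n ` board_index n \<subseteq> board_index n"
    by (intro image_subsetI flip_in_board_index)
  then show "flip n ` board_index n \<subseteq> board_index n" .
qed

lemma link_flip_iff:
  assumes "fst x < 4" "fst y < 4"
  shows "link n (flip n x) (flip n y) \<longleftrightarrow> link 0 x y"
proof -
  obtain k a b j c d where xy: "x = (k, a, b)" "y = (j, c, d)" by (cases x; cases y)
  show ?thesis
  proof (cases "odd n")
    case True
    have step: "step n (int (n div 2) - e, int (n div 2) + 1 - f) (int (n div 2) - g, int (n div 2) + 1 - h)
        \<longleftrightarrow> step 0 (e, f) (g, h)" for e f g h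
      using True by (auto simp: step_def elim!: oddE)
    show ?thesis by (simp only: xy flip_def link_def prod.case True not_False_eq_True simp_thms if_True step)
  next
    case False
    have step: "step n (int (n div 2) - f, int (n div 2) - e) (int (n div 2) - h, int (n div 2) - g)
        \<longleftrightarrow> step 0 (g, h) (e, f)" for e f g h
      using False by (auto simp: step_def elim!: evenE)
    \<comment> \<open>The map \<open>k \<mapsto> - k\<close> modulo \<open>4\<close> exchanges next and previous wing.\<close>
    have turns: "(4 - j) mod 4 = ((4 - k) mod 4 + 1) mod 4 \<longleftrightarrow> k = (j + 1) mod 4"
      if "k < 4" "j < 4" for j k :: nat
    proof -
      have "j = 0 \<or> j = 1 \<or> j = 2 \<or> j = 3" "k = 0 \<or> k = 1 \<or> k = 2 \<or> k = 3"
        using that by linarith+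
      then show ?thesis by (elim disjE) simp_all
    qed
    have "k < 4" "j < 4" using assms by (simp_all add: xy)
    then show ?thesis
      by (simp only: xy flip_def link_def prod.case False simp_thms if_False step turns disj_commute)
  qed
qed

lemma digraph_iso_pinwheel_board:
  assumes "p < q" "is_leaper p q L" "is_leaper q (p + 2 * n * q) M"
  shows "digraph_iso (leaper_graph L (pinwheel_board n p q)) (leaper_graph M (pinwheel_board n p q))"
proof -
  have L: "is_leaper q (p + 2 * 0 * q) L" using assms(2) is_leaper_commute by simp
  let ?I = "board_index n" and ?s = "site p q"
  have B: "pinwheel_board n p q = ?s ` ?I"
    using assms(1) by (intro pinwheel_board_eq) simp
  have s: "bij_betw ?s ?I (?s ` ?I)" using inj_on_site[OF assms(1)] by (rule inj_on_imp_bij_betw)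
  let ?f = "?s \<circ> flip n \<circ> the_inv_into ?I ?s"
  have "bij_betw ?f (?s ` ?I) (?s ` ?I)"
    using bij_betw_the_inv_into[OF s] bij_betw_flip s by (blast intro: bij_betw_trans)
  moreover have "?s y - ?s x \<in> L \<longleftrightarrow> ?f (?s y) - ?f (?s x) \<in> M" if "x \<in> ?I" "y \<in> ?I" for x y
  proof -
    have "?f (?s x) = ?s (flip n x)" "?f (?s y) = ?s (flip n y)"
      using that inj_on_site[OF assms(1)] by (simp_all add: the_inv_into_f_f)
    moreover have "fst x < 4" "fst y < 4" using that by (auto simp: board_index_def)
    ultimately show ?thesis
      using that site_edge_iff[OF assms(1) L, of n x y] flip_in_board_index
        site_edge_iff[OF assms(1,3), of n "flip n x" "flip n y"] link_flip_iff[of x y n]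
      by simp
  qed
  ultimately show ?thesis unfolding digraph_iso_leaper_graph_iff B by blast
qed

lemma vector_2_eq_iff: "(vector [a, b] :: 'a::zero ^ 2) = vector [c, d] \<longleftrightarrow> a = c \<and> b = d"
  by (auto simp: vec_eq_iff forall_2)

theorem theorem23:
  fixes n p q r s :: nat and L M :: leaper
  assumes "n > 0"
    and "is_leaper p q L" and "p < q"
    and "is_leaper r s M"
    and "vector [r, s] = A_pinwheel n *v vector [p, q]"
  shows "dual (pinwheel_board n p q) L M"
proof -
  have rs: "r = q" "s = p + 2 * n * q"
    using assms(5) by (simp_all add: A_pinwheel_mult vector_2_eq_iff)
  have M: "is_leaper q (p + 2 * n * q) M" using assms(4) by (simp add: rs)
  have B: "pinwheel_board n p q = site p q ` board_index n"
    using assms(3) by (intro pinwheel_board_eq) simp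
  have "q < s" using assms(1,3) unfolding rs by (cases n) auto
  then have "(int q, int s) \<in> M" "(int q, int s) \<notin> L"
    using assms(2-4) rs(1) by (auto simp: is_leaper_def)
  then have "L \<noteq> M" by blast
  moreover have "\<exists>a\<in>pinwheel_board n p q. \<exists>b\<in>pinwheel_board n p q. a \<noteq> b"
  proof -
    have "(0, 0, 0) \<in> board_index n" "(1, 0, 0) \<in> board_index n"
      using assms(1) by (auto simp: board_index_def wing_index_def)
    moreover from this have "site p q (0, 0, 0) \<noteq> site p q (1, 0, 0)"
      using inj_on_site[OF assms(3), of n] by (auto dest: inj_onD)
    ultimately show ?thesis unfolding B by blast
  qed
  moreover have iso: "digraph_iso (leaper_graph L (pinwheel_board n p q))
      (leaper_graph M (pinwheel_board n p q))"
    using digraph_iso_pinwheel_board[OF assms(3,2) M] .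
  moreover have cL: "Digraph_Component.connected (leaper_graph L (pinwheel_board n p q))"
    using connected_pinwheel_board[OF assms(3,2,1)] .
  moreover have "Digraph_Component.connected (leaper_graph M (pinwheel_board n p q))"
    using iso cL wf_digraph.connectedI_app_iso[OF wf_leaper_graph]
    unfolding digraph_iso_def by metis
  ultimately show ?thesis using assms(2) M unfolding dual_def by blast
qed

end
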